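(* Consider the closed-loop state-space average model described in the context. When saddle-node bifurcation occurs, the closed-loop matrix $\Phi_A$ has an eigenvalue at $0$, and $\det[\Phi_A]=0$. Suppose $\det[A]\ne0$; then $$\det[\Phi_A]=\det[A]\,\det\left[I+\frac{A^{-1}\left((A_1-A_2)X+(B_1-B_2)u\right)C}{V_h}\right]=0,$$ leading to the boundary condition $$V_h+CA^{-1}\left((A_1-A_2)X+(B_1-B_2)u\right)=0.$$
   Context: $A_1,A_2\in\mathbf R^{N\times N}$, $B_1,B_2\in\mathbf R^{N\times2}$, $C\in\mathbf R^{1\times N}$ are constant matrices describing a switching converter whose dynamics alternates within each clock period between $\dot x=A_1x+B_1u$ and $\dot x=A_2x+B_2u$; $u\in\mathbf R^2$ is the input (source voltage and control signal), $V_h$ is the amplitude of the ramp signal, $y$ is the compensator output compared with the ramp, and $D$ is the steady-state duty cycle. Put $A=DA_1+(1-D)A_2$ and $B=DB_1+(1-D)B_2$. In the state-space average model the power stage dynamics is $\dot x=Ax+Bu$, with steady-state solution $X:=-A^{-1}Bu$. With small perturbations denoted by hats ($\hat x=x-X$), the linearized open-loop dynamics is $\dot{\hat x}=A\hat x+((A_1-A_2)X+(B_1-B_2)u)\hat D$. In the closed loop $\hat D=\hat y/V_h=C\hat x/V_h$, so the closed-loop dynamics is $\dot{\hat x}=\Phi_A\hat x$ with $$\Phi_A:=A+\frac{((A_1-A_2)X+(B_1-B_2)u)\,C}{V_h}.$$ The average analysis is applied when the switching condition is determined by average signal values (such as in voltage mode control or average current mode control). *)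

theory Defs
  imports "HOL-Analysis.Analysis"
begin

definition eigenvalue :: "'a::field^'n^'n \<Rightarrow> 'a \<Rightarrow> bool" where
  "eigenvalue M l \<longleftrightarrow> (\<exists>v. v \<noteq> 0 \<and> M *v v = l *s v)"

text \<open>
  Saddle-node (fold) bifurcation of the one-parameter family of differential equations
  \<open>x' = f p x\<close> at parameter value \<open>p0\<close> and state \<open>x0\<close>: two distinct equilibria coexist locally on
  one side of \<open>p0\<close> (the right side if \<open>s = 1\<close>, the left side if \<open>s = -1\<close>), collide at \<open>x0\<close> when
  the parameter reaches \<open>p0\<close>, and have disappeared on the other side. The definition refers only to
  equilibria; nothing is said about the linearization.
\<close>

definition saddle_node_bifurcation ::
    "(real \<Rightarrow> 'a::real_normed_vector \<Rightarrow> 'a) \<Rightarrow> real \<Rightarrow> 'a \<Rightarrow> bool" where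
  "saddle_node_bifurcation f p0 x0 \<longleftrightarrow>
     (\<exists>s\<in>{1, -1}. \<exists>r>0. \<exists>\<delta>>0. \<exists>xa xb.
        {x \<in> ball x0 r. f p0 x = 0} = {x0} \<and>
        (\<forall>t\<in>{0<..<\<delta>}. xa t \<noteq> xb t \<and>
            {x \<in> ball x0 r. f (p0 + s * t) x = 0} = {xa t, xb t}) \<and>
        (xa \<longlongrightarrow> x0) (at_right 0) \<and> (xb \<longlongrightarrow> x0) (at_right 0) \<and>
        (\<forall>t\<in>{0<..<\<delta>}. {x \<in> ball x0 r. f (p0 - s * t) x = 0} = {}))"

definition average :: "real \<Rightarrow> 'a::real_vector \<Rightarrow> 'a \<Rightarrow> 'a" where
  "average d M1 M2 = d *\<^sub>R M1 + (1 - d) *\<^sub>R M2"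

text \<open>
  The compensator output is \<open>y = C x + c\<close>, where \<open>c\<close> collects everything that does not depend on
  the state (reference, feed-through of the input, valley of the ramp). Comparing \<open>y\<close> with a ramp
  of amplitude \<open>Vh\<close> gives the duty cycle \<open>y / Vh\<close>.
\<close>

definition duty_cycle :: "real^'n^1 \<Rightarrow> real \<Rightarrow> real \<Rightarrow> real^'n \<Rightarrow> real" where
  "duty_cycle C c Vh x = ((C *v x) $ 1 + c) / Vh"

definition closed_loop_average ::
    "real^'n^'n \<Rightarrow> real^'n^'n \<Rightarrow> real^2^'n \<Rightarrow> real^2^'n \<Rightarrow> real^'n^1 \<Rightarrow> real^2 \<Rightarrow> real \<Rightarrow> real
      \<Rightarrow> real^'n \<Rightarrow> real^'n" where
  "closed_loop_average A1 A2 B1 B2 C u c Vh x =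
     (let d = duty_cycle C c Vh x in average d A1 A2 *v x + average d B1 B2 *v u)"

text \<open>
  A saddle-node bifurcation occurs in the closed-loop average model with the given data, steady-state
  duty cycle \<open>D\<close> and steady state \<open>X\<close>: the model is the member at \<open>p = 0\<close> of a family of such models
  that undergoes a saddle-node bifurcation there. The bifurcation parameter may be
  any quantity of the circuit (source voltage, load, gain, ramp amplitude, ...), so all data may
  vary with it.
\<close>

definition average_model_saddle_node ::
    "real^'n^'n \<Rightarrow> real^'n^'n \<Rightarrow> real^2^'n \<Rightarrow> real^2^'n \<Rightarrow> real^'n^1 \<Rightarrow> real^2 \<Rightarrow> real \<Rightarrow> real
      \<Rightarrow> real^'n \<Rightarrow> bool" where
  "average_model_saddle_node A1 A2 B1 B2 C u Vh D X \<longleftrightarrow>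
     (\<exists>A1p A2p B1p B2p Cp up cp Vhp.
        isCont A1p 0 \<and> isCont A2p 0 \<and> isCont B1p 0 \<and> isCont B2p 0 \<and>
        isCont Cp 0 \<and> isCont up 0 \<and> isCont cp 0 \<and> isCont Vhp 0 \<and>
        A1p 0 = A1 \<and> A2p 0 = A2 \<and> B1p 0 = B1 \<and> B2p 0 = B2 \<and>
        Cp 0 = C \<and> up 0 = u \<and> Vhp 0 = Vh \<and>
        duty_cycle C (cp 0) Vh X = D \<and>
        saddle_node_bifurcation
          (\<lambda>p. closed_loop_average (A1p p) (A2p p) (B1p p) (B2p p) (Cp p) (up p) (cp p) (Vhp p))
          0 X)"

end

theory Submission
  imports Defs
begin

text \<open>
  The closed-loop average vector field is quadratic in the state, so its values at two states differ
  by an explicit matrix times the difference of the states, and that matrix tends to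
  \<open>\<Phi>\<^sub>A\<close> as both states and the parameter tend to the bifurcation point. The two
  equilibria that merge in a saddle-node bifurcation are distinct, so the matrix is singular along
  them, and \<open>det \<Phi>\<^sub>A = 0\<close> follows by continuity of the determinant. As \<open>\<Phi>\<^sub>A\<close> is a rank-one update
  of \<open>A\<close>, applying \<open>C A\<^sup>-\<^sup>1\<close> to a null vector gives the boundary condition.
\<close>

lemma tendsto_det:
  fixes M :: "'b \<Rightarrow> real^'n^'n"
  assumes "(M \<longlongrightarrow> L) F"
  shows "((\<lambda>t. det (M t)) \<longlongrightarrow> det L) F"
  unfolding det_def by (intro tendsto_intros assms)

lemma tendsto_matrix_mult:
  fixes M :: "'b \<Rightarrow> real^'n^'m" and N :: "'b \<Rightarrow> real^'k^'n"
  assumes "(M \<longlongrightarrow> L) F" and "(N \<longlongrightarrow> K) F"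
  shows "((\<lambda>t. M t ** N t) \<longlongrightarrow> L ** K) F"
  unfolding matrix_matrix_mult_def by (intro tendsto_intros assms)

lemma tendsto_matrix_vector_mult:
  fixes M :: "'b \<Rightarrow> real^'n^'m" and v :: "'b \<Rightarrow> real^'n"
  assumes "(M \<longlongrightarrow> L) F" and "(v \<longlongrightarrow> w) F"
  shows "((\<lambda>t. M t *v v t) \<longlongrightarrow> L *v w) F"
  unfolding matrix_vector_mult_def by (intro tendsto_intros assms)

lemma tendsto_columnvector:
  fixes v :: "'b \<Rightarrow> real^'n"
  assumes "(v \<longlongrightarrow> w) F"
  shows "((\<lambda>t. columnvector (v t)) \<longlongrightarrow> columnvector w) F"
  unfolding columnvector_def by (intro tendsto_intros assms)

text \<open>The product \<open>columnvector b ** C\<close> is the outer product of \<open>b\<close>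
  with the single row of \<open>C\<close>, so its range lies in the span of
  \<open>b\<close>.\<close>

lemma columnvector_mult_row_vector:
  fixes b :: "real^'m" and C :: "real^'n^1"
  shows "(columnvector b ** C) *v x = (C *v x) $ 1 *\<^sub>R b"
  by (simp add: vec_eq_iff columnvector_def matrix_matrix_mult_def matrix_vector_mult_def
      sum_distrib_left sum_distrib_right mult_ac)

lemma eigenvalue_0_iff_det:
  fixes M :: "real^'n^'n"
  shows "eigenvalue M 0 \<longleftrightarrow> det M = 0"
proof -
  have "det M \<noteq> 0 \<longleftrightarrow> (\<forall>x. M *v x = 0 \<longrightarrow> x = 0)"
    using invertible_det_nz invertible_left_inverse matrix_left_invertible_ker by metis
  then show ?thesis
    by (auto simp: eigenvalue_def)
qed

text \<open>An exact identity, with no linearization: keeping the duty cycle of \<open>x\<close> on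
  \<open>x - y\<close> leaves the change of duty cycle acting at \<open>y\<close>, and that change
  is linear in \<open>x - y\<close> through \<open>C\<close>. Hence the asymmetric roles of
  \<open>x\<close> and \<open>y\<close>.\<close>

lemma closed_loop_average_diff:
  "closed_loop_average A1 A2 B1 B2 C u c Vh x - closed_loop_average A1 A2 B1 B2 C u c Vh y =
     (average (duty_cycle C c Vh x) A1 A2 +
       (1 / Vh) *\<^sub>R (columnvector ((A1 - A2) *v y + (B1 - B2) *v u) ** C)) *v (x - y)"
proof -
  define dx dy where "dx = duty_cycle C c Vh x" and "dy = duty_cycle C c Vh y"
  have d: "(C *v (x - y)) $ 1 / Vh = dx - dy"
    by (simp add: dx_def dy_def duty_cycle_def matrix_vector_mult_diff_distrib diff_divide_distrib
        add_divide_distrib)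
  have "((1 / Vh) *\<^sub>R (columnvector ((A1 - A2) *v y + (B1 - B2) *v u) ** C)) *v (x - y)
      = (dx - dy) *\<^sub>R ((A1 - A2) *v y + (B1 - B2) *v u)"
    by (simp add: d [symmetric] columnvector_mult_row_vector flip: scaleR_matrix_vector_assoc)
  then show ?thesis
    unfolding closed_loop_average_def Let_def average_def dx_def [symmetric] dy_def [symmetric]
    by (simp add: algebra_simps flip: scaleR_matrix_vector_assoc)
qed

lemma saddle_node_bifurcation_equilibria:
  assumes "saddle_node_bifurcation f p0 x0"
  obtains s \<delta> xa xb where "\<delta> > 0" and "\<And>t. t \<in> {0<..<\<delta>} \<Longrightarrow> xa t \<noteq> xb t"
    and "\<And>t x. \<lbrakk>t \<in> {0<..<\<delta>}; x \<in> {xa t, xb t}\<rbrakk> \<Longrightarrow> f (p0 + s * t) x = 0"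
    and "(xa \<longlongrightarrow> x0) (at_right 0)" and "(xb \<longlongrightarrow> x0) (at_right 0)"
proof -
  from assms obtain s r \<delta> xa xb where "\<delta> > 0" and
    eq: "\<forall>t\<in>{0<..<\<delta>}. xa t \<noteq> xb t \<and> {x \<in> ball x0 r. f (p0 + s * t) x = 0} = {xa t, xb t}" and
    "(xa \<longlongrightarrow> x0) (at_right 0)" "(xb \<longlongrightarrow> x0) (at_right 0)"
    unfolding saddle_node_bifurcation_def by (elim bexE exE conjE) (rule that)
  moreover have "f (p0 + s * t) x = 0" if "t \<in> {0<..<\<delta>}" "x \<in> {xa t, xb t}" for t x
    using bspec [OF eq that(1)] that(2) by blast
  ultimately show thesis
    using that [of \<delta> xa xb s] by blast
qed

lemma average_model_saddle_node_det_eq_0: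
  fixes A1 A2 :: "real^'n^'n"
  assumes "Vh \<noteq> 0" and "average_model_saddle_node A1 A2 B1 B2 C u Vh D X"
  shows "det (average D A1 A2 +
    (1 / Vh) *\<^sub>R (columnvector ((A1 - A2) *v X + (B1 - B2) *v u) ** C)) = 0"
proof -
  from assms(2) obtain A1p A2p B1p B2p Cp up cp Vhp where
    cont: "isCont A1p 0" "isCont A2p 0" "isCont B1p 0" "isCont B2p 0"
      "isCont Cp 0" "isCont up 0" "isCont cp 0" "isCont Vhp 0" and
    at0: "A1p 0 = A1" "A2p 0 = A2" "B1p 0 = B1" "B2p 0 = B2" "Cp 0 = C" "up 0 = u" "Vhp 0 = Vh" and
    D: "duty_cycle C (cp 0) Vh X = D" and
    sn: "saddle_node_bifurcation
      (\<lambda>p. closed_loop_average (A1p p) (A2p p) (B1p p) (B2p p) (Cp p) (up p) (cp p) (Vhp p)) 0 X"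
    unfolding average_model_saddle_node_def by blast
  from sn obtain s \<delta> xa xb where "\<delta> > 0" and ne: "\<And>t. t \<in> {0<..<\<delta>} \<Longrightarrow> xa t \<noteq> xb t" and
    eq: "\<And>t x. \<lbrakk>t \<in> {0<..<\<delta>}; x \<in> {xa t, xb t}\<rbrakk> \<Longrightarrow>
      closed_loop_average (A1p (0 + s * t)) (A2p (0 + s * t)) (B1p (0 + s * t)) (B2p (0 + s * t))
        (Cp (0 + s * t)) (up (0 + s * t)) (cp (0 + s * t)) (Vhp (0 + s * t)) x = 0" and
    xa: "(xa \<longlongrightarrow> X) (at_right 0)" and xb: "(xb \<longlongrightarrow> X) (at_right 0)"
    by (rule saddle_node_bifurcation_equilibria) metis
  \<comment> \<open>The matrix of \<open>closed_loop_average_diff\<close> for the model at parameter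
    \<open>s * t\<close>, taken between the two branches: \<open>xa t\<close> sets the duty cycle,
    \<open>xb t\<close> the rank-one term.\<close>
  define M where "M t =
    average (duty_cycle (Cp (s * t)) (cp (s * t)) (Vhp (s * t)) (xa t)) (A1p (s * t)) (A2p (s * t)) +
      (1 / Vhp (s * t)) *\<^sub>R (columnvector ((A1p (s * t) - A2p (s * t)) *v xb t +
        (B1p (s * t) - B2p (s * t)) *v up (s * t)) ** Cp (s * t))" for t
  have "((\<lambda>t. s * t) \<longlongrightarrow> s * 0) (at_right 0)"
    by (intro tendsto_intros)
  then have st: "((\<lambda>t. s * t) \<longlongrightarrow> 0) (at_right 0)"
    by simp
  note lim = cont [THEN isCont_tendsto_compose, OF st, unfolded at0]
  \<comment> \<open>The limit is the steady-state duty cycle \<open>D\<close>, so the averaged part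
    of \<open>M t\<close> tends to \<open>average D A1 A2\<close>. Division by the ramp amplitude is
    continuous here because \<open>Vh\<close> is nonzero.\<close>
  have "((\<lambda>t. duty_cycle (Cp (s * t)) (cp (s * t)) (Vhp (s * t)) (xa t)) \<longlongrightarrow>
      duty_cycle C (cp 0) Vh X) (at_right 0)"
    unfolding duty_cycle_def by (intro tendsto_intros tendsto_matrix_vector_mult lim xa assms(1))
  then have "(M \<longlongrightarrow> average D A1 A2 +
      (1 / Vh) *\<^sub>R (columnvector ((A1 - A2) *v X + (B1 - B2) *v u) ** C)) (at_right 0)"
    unfolding M_def average_def D
    by (intro tendsto_intros tendsto_matrix_vector_mult tendsto_matrix_mult tendsto_columnvector
        lim xb assms(1))
  then have lim_det: "((\<lambda>t. det (M t)) \<longlongrightarrow> det (average D A1 A2 +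
      (1 / Vh) *\<^sub>R (columnvector ((A1 - A2) *v X + (B1 - B2) *v u) ** C))) (at_right 0)"
    by (rule tendsto_det)
  have "det (M t) = 0" if t: "t \<in> {0<..<\<delta>}" for t
  proof -
    \<comment> \<open>Both states are equilibria at the same parameter value, so the difference of
      the vector fields vanishes.\<close>
    have "M t *v (xa t - xb t) = 0"
      using eq [OF t, of "xa t"] eq [OF t, of "xb t"]
      by (simp add: M_def flip: closed_loop_average_diff)
    then have "eigenvalue (M t) 0"
      using ne [OF t] unfolding eigenvalue_def by (intro exI [of _ "xa t - xb t"]) simp
    then show ?thesis
      by (simp add: eigenvalue_0_iff_det)
  qed
  then have "\<forall>\<^sub>F t in at_right 0. det (M t) = 0"
    using \<open>\<delta> > 0\<close> unfolding eventually_at_right_field by (intro exI [of _ \<delta>]) auto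
  then have "((\<lambda>t. det (M t)) \<longlongrightarrow> 0) (at_right 0)"
    by (rule tendsto_eventually)
  with lim_det show ?thesis
    by (rule tendsto_unique [OF trivial_limit_at_right_real])
qed

text \<open>\<open>matrix_inv\<close> is defined by Hilbert choice; invertibility supplies the
  witness that makes the chosen matrix a two-sided inverse.\<close>

lemma
  fixes A :: "'a::semiring_1^'n^'m"
  assumes "invertible A"
  shows matrix_inv_right: "A ** matrix_inv A = mat 1"
    and matrix_inv_left: "matrix_inv A ** A = mat 1"
proof -
  have "A ** matrix_inv A = mat 1 \<and> matrix_inv A ** A = mat 1"
    using assms unfolding matrix_inv_def invertible_def by (rule someI_ex)
  then show "A ** matrix_inv A = mat 1" "matrix_inv A ** A = mat 1"
    by blast+
qed

text \<open>Pulling \<open>A\<close> out on the left turns the determinant of the update into a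
  product, by multiplicativity of \<open>det\<close>.\<close>

lemma rank_one_update_factor:
  fixes A :: "real^'n^'n" and C :: "real^'n^1"
  assumes "invertible A"
  shows "A + k *\<^sub>R (columnvector b ** C) =
    A ** (mat 1 + k *\<^sub>R (matrix_inv A ** columnvector b ** C))"
proof -
  have "A ** (matrix_inv A ** columnvector b ** C) = columnvector b ** C"
    by (simp add: matrix_mul_assoc matrix_inv_right [OF assms])
  then show ?thesis
    by (simp add: matrix_add_ldistrib matrix_scalar_ac flip: scalar_matrix_assoc)
qed

text \<open>A null vector \<open>v\<close> satisfies \<open>A *v v = - (c / k) b\<close> with the
  scalar \<open>c = C v\<close>, so \<open>v\<close> is a multiple of the inverse image of
  \<open>b\<close>. Applying \<open>C\<close> once more gives a scalar equation for
  \<open>c\<close>.\<close>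

lemma singular_rank_one_update:
  fixes A :: "real^'n^'n" and C :: "real^'n^1"
  assumes "invertible A" and "k \<noteq> 0" and "det (A + (1 / k) *\<^sub>R (columnvector b ** C)) = 0"
  shows "k + (C *v (matrix_inv A *v b)) $ 1 = 0"
proof -
  from assms(3) obtain v where "v \<noteq> 0" and "(A + (1 / k) *\<^sub>R (columnvector b ** C)) *v v = 0"
    by (auto simp: eigenvalue_0_iff_det [symmetric] eigenvalue_def)
  define c where "c = (C *v v) $ 1"
  have "A *v v = - ((c / k) *\<^sub>R b)"
    using \<open>_ *v v = 0\<close>
    by (simp add: matrix_vector_mult_add_rdistrib columnvector_mult_row_vector c_def
        eq_neg_iff_add_eq_0 flip: scaleR_matrix_vector_assoc)
  then have "matrix_inv A *v (A *v v) = - ((c / k) *\<^sub>R (matrix_inv A *v b))"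
    by (simp add: matrix_vector_mult_scaleR flip: scaleR_minus_left)
  then have v: "v = - (c / k) *\<^sub>R (matrix_inv A *v b)"
    by (simp add: matrix_vector_mul_assoc matrix_inv_left [OF assms(1)])
  \<comment> \<open>If \<open>c\<close> were zero, the formula for \<open>v\<close> would give
    \<open>v = 0\<close>; this allows \<open>c\<close> to be cancelled below.\<close>
  with \<open>v \<noteq> 0\<close> have "c \<noteq> 0"
    by auto
  have "c = - (c / k) * (C *v (matrix_inv A *v b)) $ 1"
    using arg_cong [OF v, of "\<lambda>x. (C *v x) $ 1"]
    by (simp add: c_def matrix_vector_mult_scaleR flip: scaleR_minus_left)
  then have "c * (k + (C *v (matrix_inv A *v b)) $ 1) = 0"
    using \<open>k \<noteq> 0\<close> by (simp add: field_simps)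
  with \<open>c \<noteq> 0\<close> show ?thesis
    by simp
qed

theorem mainTheorem6:
  fixes A1 A2 A \<Phi>\<^sub>A :: "real^'n^'n"
    and B1 B2 B :: "real^2^'n"
    and C :: "real^'n^1"
    and u :: "real^2"
    and V\<^sub>h D :: real
    and X :: "real^'n"
  assumes "V\<^sub>h > 0" and "0 < D" and "D < 1"
    and "A = average D A1 A2"
    and "B = average D B1 B2"
    and "X = - (matrix_inv A *v (B *v u))"
    and "\<Phi>\<^sub>A = A + (1 / V\<^sub>h) *\<^sub>R (columnvector ((A1 - A2) *v X + (B1 - B2) *v u) ** C)"
    and "average_model_saddle_node A1 A2 B1 B2 C u V\<^sub>h D X"
  shows "eigenvalue \<Phi>\<^sub>A 0 \<and> det \<Phi>\<^sub>A = 0 \<and>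
    (det A \<noteq> 0 \<longrightarrow>
      det \<Phi>\<^sub>A = det A * det (mat 1 + (1 / V\<^sub>h) *\<^sub>R
        (matrix_inv A ** columnvector ((A1 - A2) *v X + (B1 - B2) *v u) ** C)) \<and>
      det A * det (mat 1 + (1 / V\<^sub>h) *\<^sub>R
        (matrix_inv A ** columnvector ((A1 - A2) *v X + (B1 - B2) *v u) ** C)) = 0 \<and>
      V\<^sub>h + (C *v (matrix_inv A *v ((A1 - A2) *v X + (B1 - B2) *v u))) $ 1 = 0)"
proof -
  define b where "b = (A1 - A2) *v X + (B1 - B2) *v u"
  have \<Phi>: "\<Phi>\<^sub>A = A + (1 / V\<^sub>h) *\<^sub>R (columnvector b ** C)"
    using assms by (simp add: b_def)
  have det0: "det \<Phi>\<^sub>A = 0"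
    using average_model_saddle_node_det_eq_0 [of V\<^sub>h] assms by simp
  moreover have "V\<^sub>h + (C *v (matrix_inv A *v b)) $ 1 = 0" if "det A \<noteq> 0"
    using singular_rank_one_update [of A V\<^sub>h b C] that det0 \<open>V\<^sub>h > 0\<close>
    by (simp add: \<Phi> invertible_det_nz)
  \<comment> \<open>Here \<open>det_mul\<close> is read backwards, so that the factorization of the
    rank-one update applies under a single \<open>det\<close>.\<close>
  moreover have "det \<Phi>\<^sub>A = det A * det (mat 1 + (1 / V\<^sub>h) *\<^sub>R
      (matrix_inv A ** columnvector b ** C))" if "det A \<noteq> 0"
    using that unfolding \<Phi> det_mul [symmetric]
    by (metis invertible_det_nz rank_one_update_factor)
  ultimately show ?thesis
    unfolding b_def [symmetric] by (simp add: eigenvalue_0_iff_det)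
qed

end
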